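(* For every $n\ge1$, the state space $DO(n)$ with the QPE order $\sqsubseteq$ is a domain. Furthermore, writing $\bot_n=\frac1nI_n$ and $\ll$ for the way-below relation of $(DO(n),\sqsubseteq)$: (a) $(1-t)\rho+t\bot_n\ll\rho$ for every state $\rho\in DO(n)$ and every $0<t\le1$; (b) if $\rho\ll\sigma$ then $(1-t)\sigma+t\rho\ll\sigma$ for every $0<t\le1$; (c) for every state $\rho$, there exists a state $\sigma$ with $\rho\ll\sigma$ if and only if $\ker(\rho)=\{0\}$.
   Context: $DO(n)=\{A\in M_n(\mathbb{C}) : A\ge 0,\ \operatorname{tr}A=1\}$ is the set of states, where $A\ge0$ means positive semidefinite and $A\le B$ means $B-A\ge 0$. $\rho^+$ denotes the highest eigenvalue of $\rho$ (its operator norm). The QPE order on $DO(n)$ is the partial order $$\rho\sqsubseteq\sigma \iff \frac{\sigma}{\sigma^+}\le\frac{\rho}{\rho^+}\iff \sigma^+\rho-\rho^+\sigma\ge 0 .$$ For a partially ordered set $(X,\le)$: a (nonempty) subset $S$ is upwards directed when for all $x,y\in S$ there is $z\in S$ with $x,y\le z$. $X$ is directed complete when every upwards directed subset $S$ has a supremum $\vee S$. $x\ll y$ ($x$ is way below $y$) when for every upwards directed $S$ with $y\le\vee S$ there is $s\in S$ with $x\le s$. $X$ is a domain when it is directed complete and for every $x\in X$ the set $\{y : y\ll x\}$ is upwards directed with supremum $x$. *)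

theory Defs
  imports "HOL-Analysis.Analysis"
begin

definition upwards_directed :: "('a \<Rightarrow> 'a \<Rightarrow> bool) \<Rightarrow> 'a set \<Rightarrow> bool" where
  "upwards_directed le S \<longleftrightarrow> S \<noteq> {} \<and> (\<forall>x\<in>S. \<forall>y\<in>S. \<exists>z\<in>S. le x z \<and> le y z)"

definition is_supremum :: "'a set \<Rightarrow> ('a \<Rightarrow> 'a \<Rightarrow> bool) \<Rightarrow> 'a set \<Rightarrow> 'a \<Rightarrow> bool" where
  "is_supremum X le S s \<longleftrightarrow>
     s \<in> X \<and> (\<forall>x\<in>S. le x s) \<and> (\<forall>u\<in>X. (\<forall>x\<in>S. le x u) \<longrightarrow> le s u)"

definition directed_complete :: "'a set \<Rightarrow> ('a \<Rightarrow> 'a \<Rightarrow> bool) \<Rightarrow> bool" where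
  "directed_complete X le \<longleftrightarrow>
     (\<forall>S\<subseteq>X. upwards_directed le S \<longrightarrow> (\<exists>s. is_supremum X le S s))"

definition way_below :: "'a set \<Rightarrow> ('a \<Rightarrow> 'a \<Rightarrow> bool) \<Rightarrow> 'a \<Rightarrow> 'a \<Rightarrow> bool" where
  "way_below X le x y \<longleftrightarrow>
     x \<in> X \<and> y \<in> X \<and>
     (\<forall>S\<subseteq>X. \<forall>s. upwards_directed le S \<longrightarrow> is_supremum X le S s \<longrightarrow> le y s \<longrightarrow> (\<exists>z\<in>S. le x z))"

definition is_domain :: "'a set \<Rightarrow> ('a \<Rightarrow> 'a \<Rightarrow> bool) \<Rightarrow> bool" where
  "is_domain X le \<longleftrightarrow>
     reflp_on X le \<and> transp_on X le \<and> antisymp_on X le \<and>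
     directed_complete X le \<and>
     (\<forall>x\<in>X. upwards_directed le {y. way_below X le y x} \<and>
            is_supremum X le {y. way_below X le y x} x)"

text \<open>Matrices in \<open>M\<^sub>n(\<complex>)\<close> are elements of \<open>complex^'n^'n\<close>, so \<open>n = CARD('n) \<ge> 1\<close>.\<close>

definition hermitian :: "complex^'n^'n \<Rightarrow> bool" where
  "hermitian A \<longleftrightarrow> map_matrix cnj (transpose A) = A"

definition pos_semidef :: "complex^'n^'n \<Rightarrow> bool" where
  "pos_semidef A \<longleftrightarrow>
     hermitian A \<and> (\<forall>v. 0 \<le> Re (\<Sum>i\<in>UNIV. cnj (v $ i) * (A *v v) $ i))"

definition loewner_le :: "complex^'n^'n \<Rightarrow> complex^'n^'n \<Rightarrow> bool" where
  "loewner_le A B \<longleftrightarrow> pos_semidef (B - A)"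

definition states :: "(complex^'n^'n) set" where
  "states = {A. pos_semidef A \<and> trace A = 1}"

definition eigenvalue :: "complex^'n^'n \<Rightarrow> complex \<Rightarrow> bool" where
  "eigenvalue A k \<longleftrightarrow> (\<exists>v. v \<noteq> 0 \<and> A *v v = k *s v)"

text \<open>For hermitian matrices all eigenvalues are real, and the set below is finite and
  nonempty; only then is the maximum meaningful.\<close>

definition max_eigenvalue :: "complex^'n^'n \<Rightarrow> real" where
  "max_eigenvalue A = Max {x. eigenvalue A (complex_of_real x)}"

definition qpe_le :: "complex^'n^'n \<Rightarrow> complex^'n^'n \<Rightarrow> bool" where
  "qpe_le \<rho> \<sigma> \<longleftrightarrow> loewner_le (\<sigma> /\<^sub>R max_eigenvalue \<sigma>) (\<rho> /\<^sub>R max_eigenvalue \<rho>)"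

definition bot_state :: "complex^'n^'n" where
  "bot_state = (1 / real CARD('n)) *\<^sub>R mat 1"

abbreviation qpe_way_below :: "complex^'n^'n \<Rightarrow> complex^'n^'n \<Rightarrow> bool" where
  "qpe_way_below \<equiv> way_below states qpe_le"

end

theory Submission
  imports Defs
begin

text \<open>Dividing a state by its highest eigenvalue identifies the QPE order with the reverse
  Loewner order on the positive semidefinite \<open>M \<le> I\<close> having eigenvalue \<open>1\<close>. This set is compact, so a
  directed family has an infimum lying in its norm closure.

  The key point is that \<open>\<tau> \<lless> \<rho>\<close> holds iff the normal forms satisfy \<open>(1 - s) M\<^sub>\<rho> + s I \<le> M\<^sub>\<tau>\<close> for some
  \<open>0 < s \<le> 1\<close>. The states with normal form \<open>(1 - s) M\<^sub>\<rho> + s I\<close> form a chain with supremum \<open>\<rho>\<close>, which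
  gives one direction. Conversely, let \<open>L \<le> M\<^sub>\<rho>\<close> be the infimum of a directed family of normal forms.
  For \<open>Z\<close> in the family near \<open>L\<close>, the matrix \<open>Z - L\<close> is small and satisfies \<open>0 \<le> Z - L \<le> I - L\<close>. It
  thus vanishes on \<open>ker (I - L)\<close>, so \<open>Z - L \<le> s (I - L)\<close>, that is, \<open>Z \<le> (1 - s) L + s I\<close>. All
  claims follow by algebra from this description of \<open>\<lless>\<close>.\<close>

section \<open>Quadratic forms of hermitian matrices\<close>

text \<open>The inner product on \<open>complex^'n\<close> is the real part of the hermitian one.
  For hermitian \<open>A\<close> the hermitian form is real anyway, so nothing is lost and real
  inner product arguments apply.\<close>

definition qform :: "complex^'n^'n \<Rightarrow> complex^'n \<Rightarrow> real" where
  "qform A v = v \<bullet> (A *v v)"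

lemma inner_complex_vec: "v \<bullet> w = Re (\<Sum>i\<in>UNIV. cnj (v $ i) * w $ i)"
  for v w :: "complex^'n"
  by (simp add: inner_vec_def inner_complex_def)

text \<open>Through the interpretation \<open>mv\<close> this supplies linearity, continuity and
  norm bounds for the matrix-vector product.\<close>

lemma bounded_bilinear_matrix_vector_mult:
  "bounded_bilinear ((*v) :: complex^'n^'m \<Rightarrow> complex^'n \<Rightarrow> complex^'m)"
  unfolding bilinear_conv_bounded_bilinear [symmetric] bilinear_def
  by (auto intro!: linearI simp: matrix_vector_mult_def vec_eq_iff algebra_simps sum.distrib
      scaleR_sum_right)

interpretation mv: bounded_bilinear "(*v) :: complex^'n^'m \<Rightarrow> complex^'n \<Rightarrow> complex^'m"
  by (rule bounded_bilinear_matrix_vector_mult)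

lemma hermitian_iff: "hermitian A \<longleftrightarrow> (\<forall>i j. cnj (A $ j $ i) = A $ i $ j)"
  by (simp add: hermitian_def map_matrix_def transpose_def vec_eq_iff)

lemma hermitian_add: "hermitian A \<Longrightarrow> hermitian B \<Longrightarrow> hermitian (A + B)"
  and hermitian_diff: "hermitian A \<Longrightarrow> hermitian B \<Longrightarrow> hermitian (A - B)"
  and hermitian_scaleR: "hermitian A \<Longrightarrow> hermitian (c *\<^sub>R A)"
  and hermitian_mat_1: "hermitian (mat 1)"
  by (auto simp: hermitian_iff mat_def)

lemma hermitian_inner:
  assumes "hermitian A"
  shows "x \<bullet> (A *v y) = (A *v x) \<bullet> y"
proof -
  have "(\<Sum>i\<in>UNIV. cnj (x $ i) * (A *v y) $ i)
      = (\<Sum>i\<in>UNIV. \<Sum>j\<in>UNIV. cnj (x $ i) * A $ i $ j * y $ j)"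
    by (simp add: matrix_vector_mult_def sum_distrib_left mult.assoc)
  also have "\<dots> = (\<Sum>j\<in>UNIV. \<Sum>i\<in>UNIV. cnj (x $ i) * A $ i $ j * y $ j)"
    by (rule sum.swap)
  also have "\<dots> = (\<Sum>j\<in>UNIV. cnj ((A *v x) $ j) * y $ j)"
    using assms by (simp add: matrix_vector_mult_def sum_distrib_left sum_distrib_right hermitian_iff mult_ac)
  finally show ?thesis
    by (simp add: inner_complex_vec)
qed

lemma qform_add: "qform (A + B) v = qform A v + qform B v"
  and qform_diff: "qform (A - B) v = qform A v - qform B v"
  and qform_scaleR: "qform (c *\<^sub>R A) v = c * qform A v"
  and qform_mat_1: "qform (mat 1) v = v \<bullet> v"
  and qform_scaleR_right: "qform A (c *\<^sub>R v) = c\<^sup>2 * qform A v"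
  by (simp_all add: qform_def mv.add_left mv.diff_left mv.scaleR_left mv.scaleR_right inner_add_right
      inner_diff_right power2_eq_square)

lemmas qform_simps = qform_add qform_diff qform_scaleR qform_mat_1

lemma qform_add_right:
  assumes "hermitian A"
  shows "qform A (x + y) = qform A x + 2 * (x \<bullet> (A *v y)) + qform A y"
  using hermitian_inner[OF assms, of x y]
  by (simp add: qform_def mv.add_right inner_add_left inner_add_right inner_commute)

lemma pos_semidef_iff: "pos_semidef A \<longleftrightarrow> hermitian A \<and> (\<forall>v. 0 \<le> qform A v)"
  unfolding pos_semidef_def qform_def inner_complex_vec ..

lemma loewner_le_iff:
  assumes "hermitian A" "hermitian B"
  shows "loewner_le A B \<longleftrightarrow> (\<forall>v. qform A v \<le> qform B v)"
  using assms by (simp add: loewner_le_def pos_semidef_iff hermitian_diff qform_diff)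

text \<open>The form at \<open>x + t y\<close> is a nonnegative quadratic polynomial in the real
  variable \<open>t\<close>, so its discriminant is not positive. A vanishing leading coefficient is
  treated separately.\<close>

lemma pos_semidef_Cauchy_Schwarz:
  assumes "pos_semidef A"
  shows "(x \<bullet> (A *v y))\<^sup>2 \<le> qform A x * qform A y"
proof -
  have herm: "hermitian A" and nonneg: "0 \<le> qform A v" for v
    using assms by (auto simp: pos_semidef_iff)
  define b where "b = x \<bullet> (A *v y)"
  have *: "0 \<le> qform A x + 2 * t * b + t\<^sup>2 * qform A y" for t
    using nonneg[of "x + t *\<^sub>R y"]
    by (simp add: qform_add_right[OF herm] qform_scaleR_right mv.scaleR_right b_def)
  show ?thesis
  proof (cases "qform A y = 0")
    case True
    have "b = 0"
    proof (rule ccontr)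
      assume "b \<noteq> 0"
      then show False
        \<comment> \<open>At this \<open>t\<close> the polynomial, which is now affine, takes the
          value \<open>-1\<close>.\<close>
        using *[of "- (qform A x + 1) / (2 * b)"] True by (simp add: field_simps)
    qed
    then show ?thesis
      using True by (simp add: b_def)
  next
    case False
    then have "0 < qform A y"
      using nonneg[of y] by simp
    then show ?thesis
      \<comment> \<open>This \<open>t\<close> is the minimizer of the polynomial.\<close>
      using *[of "- b / qform A y"]
      by (simp add: b_def[symmetric] field_simps power2_eq_square)
  qed
qed

text \<open>Cauchy-Schwarz with \<open>x = A *v v\<close> bounds the square of
  \<open>x \<bullet> x\<close> by 0. This turns equality in a form inequality into a linear
  equation.\<close>

lemma pos_semidef_kernel:
  assumes "pos_semidef A" "qform A v = 0"
  shows "A *v v = 0"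
  using pos_semidef_Cauchy_Schwarz[OF assms(1), of "A *v v" v] assms(2)
  by simp

lemma pos_semidef_qform_eq_0:
  assumes "pos_semidef A" "\<And>v. qform A v = 0"
  shows "A = 0"
  using pos_semidef_kernel[OF assms(1) assms(2)] by (simp add: matrix_eq)

lemma loewner_le_antisym:
  assumes "loewner_le A B" "loewner_le B A"
  shows "A = B"
proof -
  have "qform (A - B) v = 0" for v
    using assms by (simp add: loewner_le_def pos_semidef_iff qform_diff antisym)
  moreover have "pos_semidef (A - B)"
    using assms(2) by (simp add: loewner_le_def)
  ultimately have "A - B = 0"
    by (intro pos_semidef_qform_eq_0)
  then show ?thesis
    by simp
qed

section \<open>Extremal values of forms and the highest eigenvalue\<close>

text \<open>The form is continuous and the unit sphere of \<open>K\<close> is compact. Homogeneity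
  of degree 2 extends the bound from the sphere to \<open>K\<close>.\<close>

lemma qform_attains_sup_on_sphere:
  fixes A :: "complex^'n^'n"
  assumes "subspace K" "K \<noteq> {0}"
  obtains v where "v \<in> K" "norm v = 1" "\<And>w. w \<in> K \<Longrightarrow> qform A w \<le> qform A v * (w \<bullet> w)"
proof -
  obtain x where x: "x \<in> K" "x \<noteq> 0"
    using assms subspace_0 by blast
  have "(1 / norm x) *\<^sub>R x \<in> K \<inter> sphere 0 1"
    using x assms(1) by (simp add: subspace_scale)
  then have "K \<inter> sphere 0 1 \<noteq> {}"
    by blast
  moreover have "compact (K \<inter> sphere 0 1)"
    using closed_subspace[OF assms(1)] by (simp add: closed_Int_compact)
  moreover have "continuous_on (K \<inter> sphere 0 1) (qform A)"
    unfolding qform_def by (intro continuous_intros mv.continuous_on)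
  ultimately obtain v where v: "v \<in> K \<inter> sphere 0 1"
    and max: "\<And>w. w \<in> K \<inter> sphere 0 1 \<Longrightarrow> qform A w \<le> qform A v"
    using continuous_attains_sup[of "K \<inter> sphere 0 1" "qform A"] by metis
  show thesis
  proof
    show "v \<in> K" "norm v = 1" using v by auto
    fix w assume w: "w \<in> K"
    show "qform A w \<le> qform A v * (w \<bullet> w)"
    proof (cases "w = 0")
      case True
      then show ?thesis by (simp add: qform_def)
    next
      case False
      then have "qform A ((1 / norm w) *\<^sub>R w) \<le> qform A v"
        using w assms(1) by (intro max) (simp add: subspace_scale)
      then show ?thesis
        using False
        by (simp add: qform_scaleR_right power_divide divide_le_eq flip: power2_norm_eq_inner)
    qed
  qed
qed

lemma vector_scalar_mult_of_real: "complex_of_real k *s v = k *\<^sub>R v"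
  by (simp add: vec_eq_iff) (simp add: scaleR_conv_of_real)

text \<open>Eigenvectors for distinct eigenvalues are orthogonal, hence independent, so there are
  finitely many. This makes the \<open>Max\<close> in \<open>max_eigenvalue\<close>
  meaningful.\<close>

lemma finite_real_eigenvalues:
  assumes "hermitian A"
  shows "finite {x. eigenvalue A (complex_of_real x)}" (is "finite ?E")
proof -
  have "\<forall>x\<in>?E. \<exists>v. v \<noteq> 0 \<and> A *v v = x *\<^sub>R v"
    by (simp add: eigenvalue_def vector_scalar_mult_of_real)
  then obtain f where f: "\<And>x. x \<in> ?E \<Longrightarrow> f x \<noteq> 0 \<and> A *v f x = x *\<^sub>R f x"
    by metis
  have orth: "f x \<bullet> f y = 0" if "x \<in> ?E" "y \<in> ?E" "x \<noteq> y" for x y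
    using hermitian_inner[OF assms, of "f x" "f y"] f[OF that(1)] f[OF that(2)] that(3) by simp
  have "inj_on f ?E"
  proof (rule inj_onI, rule ccontr)
    fix x y assume "x \<in> ?E" "y \<in> ?E" "f x = f y" "x \<noteq> y"
    with orth[of x y] f[of x] show False by simp
  qed
  moreover have "independent (f ` ?E)"
  proof (rule pairwise_orthogonal_independent)
    show "pairwise orthogonal (f ` ?E)"
      using orth by (auto simp: pairwise_def orthogonal_def)
    show "0 \<notin> f ` ?E"
      using f by (metis imageE)
  qed
  then have "finite (f ` ?E)"
    by (rule independent_imp_finite)
  ultimately show ?thesis
    using finite_image_iff by blast
qed

text \<open>At an eigenvector the form equals the eigenvalue times the squared norm, so the form
  bound limits every eigenvalue, and \<open>v\<close> shows that the bound is attained.\<close>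

lemma max_eigenvalue_eqI:
  assumes "hermitian A" "v \<noteq> 0" "A *v v = k *\<^sub>R v" "\<And>w. qform A w \<le> k * (w \<bullet> w)"
  shows "max_eigenvalue A = k"
  unfolding max_eigenvalue_def
proof (rule Max_eqI)
  show "finite {x. eigenvalue A (complex_of_real x)}"
    by (rule finite_real_eigenvalues) fact
  show "k \<in> {x. eigenvalue A (complex_of_real x)}"
    using assms(2,3) by (auto simp: eigenvalue_def vector_scalar_mult_of_real)
  fix y assume "y \<in> {x. eigenvalue A (complex_of_real x)}"
  then obtain w where "w \<noteq> 0" "A *v w = y *\<^sub>R w"
    by (auto simp: eigenvalue_def vector_scalar_mult_of_real)
  then show "y \<le> k"
    using assms(4)[of w] by (simp add: qform_def)
qed

text \<open>Rayleigh principle: if \<open>v\<close> maximizes the form on the unit sphere with value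
  \<open>k\<close>, then \<open>k I - A\<close> is positive semidefinite with form 0 at
  \<open>v\<close>, so it kills \<open>v\<close>.\<close>

lemma hermitian_max_eigenvector:
  fixes A :: "complex^'n^'n"
  assumes "hermitian A"
  obtains v where "norm v = 1" "A *v v = max_eigenvalue A *\<^sub>R v"
    "\<And>w. qform A w \<le> max_eigenvalue A * (w \<bullet> w)"
proof -
  have "(UNIV :: (complex^'n) set) \<noteq> {0}"
    by (metis UNIV_I axis_eq_0_iff singletonD zero_neq_one)
  then obtain v where v: "norm v = 1" and max: "\<And>w. qform A w \<le> qform A v * (w \<bullet> w)"
    using qform_attains_sup_on_sphere[of UNIV A] by auto
  define k where "k = qform A v"
  have "pos_semidef (k *\<^sub>R mat 1 - A)"
    using max assms
    by (simp add: pos_semidef_iff k_def qform_simps hermitian_diff hermitian_scaleR hermitian_mat_1)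
  moreover have "qform (k *\<^sub>R mat 1 - A) v = 0"
    using v by (simp add: qform_simps k_def flip: power2_norm_eq_inner)
  ultimately have "(k *\<^sub>R mat 1 - A) *v v = 0"
    by (rule pos_semidef_kernel)
  then have eig: "A *v v = k *\<^sub>R v"
    by (simp add: mv.diff_left mv.scaleR_left)
  moreover have "max_eigenvalue A = k"
    using max_eigenvalue_eqI[OF assms _ eig] v max k_def by fastforce
  ultimately show thesis
    using that v max k_def by simp
qed

text \<open>The form attains its minimum on the unit sphere of \<open>K\<close>, and a minimum of 0
  would produce a nonzero kernel vector in \<open>K\<close>.\<close>

lemma pos_semidef_lower_bound:
  fixes A :: "complex^'n^'n"
  assumes "pos_semidef A" "subspace K" "\<And>w. w \<in> K \<Longrightarrow> A *v w = 0 \<Longrightarrow> w = 0"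
  obtains d where "d > 0" "\<And>w. w \<in> K \<Longrightarrow> d * (w \<bullet> w) \<le> qform A w"
proof (cases "K = {0}")
  case True
  show thesis
    by (rule that[of 1]) (simp_all add: True qform_def)
next
  case False
  \<comment> \<open>Maximizing the form of \<open>- A\<close> minimizes that of
    \<open>A\<close>.\<close>
  obtain v where v: "v \<in> K" "norm v = 1"
    and max: "\<And>w. w \<in> K \<Longrightarrow> qform (- A) w \<le> qform (- A) v * (w \<bullet> w)"
    using qform_attains_sup_on_sphere[OF assms(2) False] by metis
  have neg: "qform (- A) w = - qform A w" for w
    using qform_scaleR[of "-1" A] by simp
  have "qform A v \<noteq> 0"
    using pos_semidef_kernel[OF assms(1), of v] assms(3)[of v] v by auto
  then have "qform A v > 0"
    using assms(1) by (simp add: pos_semidef_iff less_le)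
  then show thesis
    using max by (intro that[of "qform A v"]) (auto simp: neg)
qed

text \<open>Both forms vanish on \<open>ker A\<close>, and on its orthogonal complement \<open>A\<close> is bounded below by
  a positive multiple of the identity.\<close>
lemma pos_semidef_small_le_scaleR:
  fixes A :: "complex^'n^'n"
  assumes A: "pos_semidef A" and "s > 0"
  obtains e where "e > 0"
    "\<And>B v. pos_semidef B \<Longrightarrow> loewner_le B A \<Longrightarrow> norm B < e \<Longrightarrow> qform B v \<le> s * qform A v"
proof -
  define K where "K = {v. A *v v = 0}"
  have span: "span K = K"
    unfolding span_eq_iff K_def by (auto simp: subspace_def mv.add_right mv.scaleR_right)
  define L where "L = {w. \<forall>k\<in>K. orthogonal k w}"
  have "subspace L"
    unfolding L_def by (rule subspace_orthogonal_to_vectors)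
  \<comment> \<open>Such a \<open>w\<close> lies in \<open>K\<close> and in its orthogonal
    complement, so it is orthogonal to itself.\<close>
  moreover have "w = 0" if "w \<in> L" "A *v w = 0" for w
    using that unfolding L_def K_def by (auto simp: orthogonal_def)
  ultimately obtain d where d: "d > 0" "\<And>w. w \<in> L \<Longrightarrow> d * (w \<bullet> w) \<le> qform A w"
    using pos_semidef_lower_bound[OF A] by metis
  obtain C where C: "C > 0" "\<And>(B :: complex^'n^'n) v. norm (B *v v) \<le> norm B * norm v * C"
    using mv.pos_bounded by blast
  show thesis
  proof
    \<comment> \<open>With this radius the operator bound \<open>norm B * C\<close> stays below
      \<open>s * d\<close>.\<close>
    show "s * d / C > 0"
      using d C \<open>s > 0\<close> by simp
    fix B v assume B: "pos_semidef B" "loewner_le B A" "norm B < s * d / C"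
    obtain k w where k: "k \<in> K" and w: "\<And>x. x \<in> K \<Longrightarrow> orthogonal w x" and v: "v = k + w"
      using orthogonal_subspace_decomp_exists[of K v] span by metis
    have "w \<in> L"
      using w by (simp add: L_def orthogonal_commute)
    have Ak: "A *v k = 0"
      using k by (simp add: K_def)
    have herm: "hermitian A" "hermitian B"
      using A B by (auto simp: pos_semidef_iff)
    \<comment> \<open>\<open>B\<close> lies between 0 and \<open>A\<close>, and the form of
      \<open>A\<close> vanishes at \<open>k\<close>.\<close>
    have "qform B k \<le> qform A k"
      using B(2) herm by (simp add: loewner_le_iff)
    then have "qform B k = 0"
      using Ak B(1) by (simp add: qform_def pos_semidef_iff antisym)
    then have Bk: "B *v k = 0"
      by (rule pos_semidef_kernel[OF B(1)])
    have "qform B v = qform B w"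
      unfolding v by (simp add: qform_add_right[OF herm(2)] hermitian_inner[OF herm(2)] Bk)
        (simp add: qform_def Bk)
    also have "\<dots> \<le> norm w * norm (B *v w)"
      unfolding qform_def by (rule norm_cauchy_schwarz)
    also have "\<dots> \<le> norm w * (norm B * norm w * C)"
      by (intro mult_left_mono C) simp
    also have "\<dots> = (norm B * C) * (w \<bullet> w)"
      by (simp add: power2_norm_eq_inner[symmetric] power2_eq_square)
    also have "\<dots> \<le> (s * d) * (w \<bullet> w)"
      using B(3) C(1) by (intro mult_right_mono) (simp_all add: field_simps)
    also have "\<dots> \<le> s * qform A w"
      using d(2)[OF \<open>w \<in> L\<close>] \<open>s > 0\<close> by simp
    also have "qform A w = qform A v"
      unfolding v by (simp add: qform_add_right[OF herm(1)] hermitian_inner[OF herm(1)] Ak)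
        (simp add: qform_def Ak)
    finally show "qform B v \<le> s * qform A v" .
  qed
qed


section \<open>Normal forms of states\<close>

text \<open>This is exactly the set of normal forms of states. The eigenvector is normalized so that
  compactness of the sphere can be used to prove closedness.\<close>

definition unit_effects :: "(complex^'n^'n) set" where
  "unit_effects = {M. pos_semidef M \<and> (\<forall>v. qform M v \<le> v \<bullet> v) \<and> (\<exists>v. norm v = 1 \<and> M *v v = v)}"

definition normalized :: "complex^'n^'n \<Rightarrow> complex^'n^'n" where
  "normalized \<rho> = \<rho> /\<^sub>R max_eigenvalue \<rho>"

lemma qpe_le_iff: "qpe_le \<rho> \<sigma> \<longleftrightarrow> loewner_le (normalized \<sigma>) (normalized \<rho>)"
  by (simp add: qpe_le_def normalized_def)

lemma unit_effectsD:
  assumes "M \<in> unit_effects"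
  shows "hermitian M" "pos_semidef M" "0 \<le> qform M v" "qform M v \<le> v \<bullet> v"
  using assms by (auto simp: unit_effects_def pos_semidef_iff)

lemma trace_scaleR: "trace (c *\<^sub>R A) = complex_of_real c * trace A"
  by (simp add: trace_def sum_distrib_left) (simp add: scaleR_conv_of_real)

text \<open>Otherwise the form would be both nonnegative and nonpositive, forcing the zero matrix,
  whose trace is not 1.\<close>

lemma max_eigenvalue_state:
  assumes "\<rho> \<in> states"
  shows "max_eigenvalue \<rho> > 0"
proof (rule ccontr)
  assume neg: "\<not> max_eigenvalue \<rho> > 0"
  have psd: "pos_semidef \<rho>"
    using assms by (simp add: states_def)
  then obtain v where "\<And>w. qform \<rho> w \<le> max_eigenvalue \<rho> * (w \<bullet> w)"
    using hermitian_max_eigenvector[of \<rho>] by (auto simp: pos_semidef_iff)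
  moreover have "max_eigenvalue \<rho> * (w \<bullet> w) \<le> 0" for w :: "complex^'n"
    using neg by (simp add: mult_nonpos_nonneg)
  ultimately have "qform \<rho> w \<le> 0" for w
    by (meson order_trans)
  then have "qform \<rho> w = 0" for w
    using psd by (simp add: pos_semidef_iff antisym)
  then have "\<rho> = 0"
    by (rule pos_semidef_qform_eq_0[OF psd])
  then show False
    using assms by (simp add: states_def trace_def)
qed

lemma normalized_in_unit_effects:
  assumes "\<rho> \<in> states"
  shows "normalized \<rho> \<in> unit_effects"
proof -
  have pos: "max_eigenvalue \<rho> > 0"
    by (rule max_eigenvalue_state) fact
  have psd: "pos_semidef \<rho>"
    using assms by (simp add: states_def)
  then obtain v where v: "norm v = 1" "\<rho> *v v = max_eigenvalue \<rho> *\<^sub>R v"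
    and le: "\<And>w. qform \<rho> w \<le> max_eigenvalue \<rho> * (w \<bullet> w)"
    using hermitian_max_eigenvector[of \<rho>] by (auto simp: pos_semidef_iff)
  have "normalized \<rho> *v v = v"
    using v pos by (simp add: normalized_def mv.scaleR_left)
  moreover have "qform (normalized \<rho>) w \<le> w \<bullet> w" for w
    using le[of w] pos by (simp add: normalized_def qform_scaleR field_simps)
  moreover have "pos_semidef (normalized \<rho>)"
    using psd pos by (simp add: normalized_def pos_semidef_iff hermitian_scaleR qform_scaleR)
  ultimately show ?thesis
    using v(1) by (auto simp: unit_effects_def)
qed

lemma max_eigenvalue_scaleR_unit_effect:
  assumes "M \<in> unit_effects" "c \<ge> 0"
  shows "max_eigenvalue (c *\<^sub>R M) = c"
proof -
  obtain v where v: "norm v = 1" "M *v v = v"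
    using assms(1) by (auto simp: unit_effects_def)
  show ?thesis
  proof (rule max_eigenvalue_eqI)
    show "hermitian (c *\<^sub>R M)"
      by (intro hermitian_scaleR unit_effectsD assms)
    show "v \<noteq> 0" "(c *\<^sub>R M) *v v = c *\<^sub>R v"
      using v by (auto simp: mv.scaleR_left)
    show "qform (c *\<^sub>R M) w \<le> c * (w \<bullet> w)" for w
      using assms by (simp add: qform_scaleR unit_effectsD mult_left_mono)
  qed
qed

lemma normalized_scaleR_unit_effect:
  assumes "M \<in> unit_effects" "c > 0"
  shows "normalized (c *\<^sub>R M) = M"
  using assms by (simp add: normalized_def max_eigenvalue_scaleR_unit_effect)

text \<open>The trace is the sum of the form over the basis vectors. Were it 0, every basis vector
  would lie in the kernel, so \<open>M = 0\<close>, which fixes no unit vector.\<close>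

lemma trace_unit_effect:
  fixes M :: "complex^'n^'n"
  assumes "M \<in> unit_effects"
  obtains r where "r > 0" "trace M = complex_of_real r"
proof -
  have psd: "pos_semidef M"
    by (rule unit_effectsD) fact
  have diag: "M $ i $ i = complex_of_real (Re (M $ i $ i))" for i
    using unit_effectsD(1)[OF assms] by (simp add: hermitian_iff complex_eq_iff)
      (metis add.inverse_neutral cnj.simps(2) equal_neg_zero)
  have col: "(M *v axis i 1) $ j = M $ j $ i" for i j
    by (simp add: matrix_vector_mult_def axis_def if_distrib cong: if_cong)
  have form: "qform M (axis i 1) = Re (M $ i $ i)" for i
    by (simp add: qform_def inner_axis' col inner_complex_def)
  define r where "r = (\<Sum>i\<in>UNIV. Re (M $ i $ i))"
  have "trace M = complex_of_real r"
    unfolding trace_def r_def of_real_sum using diag by (intro sum.cong) auto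
  moreover have "r \<noteq> 0"
  proof
    assume "r = 0"
    then have "Re (M $ i $ i) = 0" for i
      using unit_effectsD(3)[OF assms, of "axis _ 1"]
      by (simp add: r_def form sum_nonneg_eq_0_iff)
    then have "M *v axis i 1 = 0" for i
      by (intro pos_semidef_kernel[OF psd]) (simp add: form)
    then have "M $ j $ i = 0" for i j
      using col by (metis zero_index)
    then have "M = 0"
      by (simp add: vec_eq_iff)
    then show False
      using assms by (auto simp: unit_effects_def)
  qed
  moreover have "r \<ge> 0"
    using unit_effectsD(3)[OF assms, of "axis _ 1"] by (simp add: r_def form sum_nonneg)
  ultimately show thesis
    using that by simp
qed

text \<open>Dividing \<open>M\<close> by its positive trace gives a state, and normalization undoes
  positive scalings.\<close>

lemma normalized_surj:
  assumes "M \<in> unit_effects"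
  obtains \<rho> where "\<rho> \<in> states" "normalized \<rho> = M"
proof -
  obtain r where r: "r > 0" "trace M = complex_of_real r"
    by (rule trace_unit_effect[OF assms])
  have "M /\<^sub>R r \<in> states"
    using r unit_effectsD[OF assms]
    by (simp add: states_def pos_semidef_iff hermitian_scaleR qform_scaleR trace_scaleR)
  then show thesis
    using that normalized_scaleR_unit_effect[OF assms, of "inverse r"] r by simp
qed

text \<open>States have trace 1, so the trace of a normal form is the inverse of the highest
  eigenvalue, and the scaling can be recovered.\<close>

lemma normalized_inj:
  assumes "\<rho> \<in> states" "\<sigma> \<in> states" "normalized \<rho> = normalized \<sigma>"
  shows "\<rho> = \<sigma>"
proof -
  have "trace (normalized \<rho>) = trace (normalized \<sigma>)"
    using assms by simp
  then have "max_eigenvalue \<rho> = max_eigenvalue \<sigma>"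
    using assms(1,2) by (simp add: normalized_def trace_scaleR states_def)
  then show ?thesis
    using assms max_eigenvalue_state[of \<rho>] by (simp add: normalized_def)
qed

section \<open>The Loewner and QPE orders\<close>

lemma loewner_le_refl: "loewner_le A A"
  by (simp add: loewner_le_def pos_semidef_iff hermitian_iff qform_def)

lemma loewner_le_trans:
  assumes "loewner_le A B" "loewner_le B C"
  shows "loewner_le A C"
proof -
  have "hermitian ((B - A) + (C - B))"
    using assms by (intro hermitian_add) (simp_all add: loewner_le_def pos_semidef_iff)
  moreover have "0 \<le> qform ((B - A) + (C - B)) v" for v
    using assms unfolding qform_add by (intro add_nonneg_nonneg) (simp_all add: loewner_le_def pos_semidef_iff)
  ultimately show ?thesis
    by (simp add: loewner_le_def pos_semidef_iff)
qed

lemma reflp_on_qpe_le: "reflp_on states qpe_le"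
  by (simp add: reflp_on_def qpe_le_iff loewner_le_refl)

lemma transp_on_qpe_le: "transp_on S qpe_le"
proof (rule transp_onI)
  show "qpe_le x z" if "qpe_le x y" "qpe_le y z" for x y z
    using that loewner_le_trans unfolding qpe_le_iff by blast
qed

lemma antisymp_on_qpe_le: "antisymp_on states qpe_le"
proof (rule antisymp_onI)
  fix \<rho> \<sigma> :: "complex^'n^'n"
  assume "\<rho> \<in> states" "\<sigma> \<in> states" "qpe_le \<rho> \<sigma>" "qpe_le \<sigma> \<rho>"
  then show "\<rho> = \<sigma>"
    unfolding qpe_le_iff using loewner_le_antisym normalized_inj by blast
qed

section \<open>Compactness of the set of normal forms\<close>

lemma closed_pos_semidef: "closed {A :: complex^'n^'n. pos_semidef A}"
proof -
  have "closed {A :: complex^'n^'n. \<forall>i j. cnj (A $ j $ i) = A $ i $ j}"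
    by (intro closed_Collect_all closed_Collect_eq continuous_intros)
  moreover have "closed {A :: complex^'n^'n. \<forall>v. 0 \<le> qform A v}"
    unfolding qform_def
    by (intro closed_Collect_all closed_Collect_le continuous_intros mv.continuous_on)
  ultimately show ?thesis
    by (simp add: pos_semidef_iff hermitian_iff Collect_conj_eq closed_Int)
qed

text \<open>Both sets are preimages of the closed positive cone under continuous maps. Hence Loewner
  bounds on a family pass to its closure.\<close>

lemma closed_loewner_atMost: "closed {A. loewner_le A B}"
  and closed_loewner_atLeast: "closed {A. loewner_le B A}"
  unfolding loewner_le_def
  using continuous_closed_vimage[OF closed_pos_semidef, of "\<lambda>A. B - A"]
    continuous_closed_vimage[OF closed_pos_semidef, of "\<lambda>A. A - B"]
  by (simp_all add: vimage_def)

text \<open>Cauchy-Schwarz for \<open>M *v v\<close> and \<open>v\<close>, together with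
  \<open>M \<le> I\<close>, bounds the fourth power of \<open>norm (M *v v)\<close> by the product
  of both squared norms; one factor cancels.\<close>

lemma norm_matrix_vector_mult_unit_effect:
  assumes "M \<in> unit_effects"
  shows "norm (M *v v) \<le> norm v"
proof -
  have "((M *v v) \<bullet> (M *v v))\<^sup>2 \<le> qform M (M *v v) * qform M v"
    by (rule pos_semidef_Cauchy_Schwarz) (rule unit_effectsD[OF assms])
  also have "\<dots> \<le> ((M *v v) \<bullet> (M *v v)) * (v \<bullet> v)"
    by (intro mult_mono unit_effectsD[OF assms]) simp
  finally have "(M *v v) \<bullet> (M *v v) \<le> v \<bullet> v"
    by (cases "M *v v = 0") (simp_all add: power2_eq_square)
  then show ?thesis
    by (simp add: norm_le)
qed

text \<open>Columns are images of unit vectors, so every entry has modulus at most 1.\<close>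

lemma bounded_unit_effects: "bounded (unit_effects :: (complex^'n^'n) set)"
proof -
  have "norm M \<le> (\<Sum>j\<in>(UNIV :: 'n set). \<Sum>i\<in>(UNIV :: 'n set). 1)" if M: "M \<in> unit_effects" for M :: "complex^'n^'n"
  proof -
    have "norm (M $ j $ i) \<le> 1" for i j
    proof -
      have "M $ j $ i = (M *v axis i 1) $ j"
        by (simp add: matrix_vector_mult_def axis_def if_distrib cong: if_cong)
      also have "norm \<dots> \<le> norm (M *v axis i 1)"
        by (rule Finite_Cartesian_Product.norm_nth_le)
      also have "\<dots> \<le> 1"
        using norm_matrix_vector_mult_unit_effect[OF M, of "axis i 1"] by simp
      finally show ?thesis .
    qed
    then have "norm (M $ j) \<le> (\<Sum>i\<in>(UNIV :: 'n set). 1)" for j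
      unfolding norm_vec_def[of "M $ j"] by (intro order_trans[OF L2_set_le_sum] sum_mono) auto
    then show ?thesis
      unfolding norm_vec_def[of M] by (intro order_trans[OF L2_set_le_sum] sum_mono) auto
  qed
  then show ?thesis
    unfolding bounded_iff by blast
qed

text \<open>Only the eigenvalue condition needs care: unit fixed vectors of a convergent sequence of
  matrices have a subsequence converging to a unit vector, which the limit matrix fixes.\<close>

lemma closed_unit_effects: "closed (unit_effects :: (complex^'n^'n) set)"
proof -
  have eig: "closed {M :: complex^'n^'n. \<exists>v\<in>sphere 0 1. M *v v = v}"
    unfolding closed_sequential_limits
  proof (intro allI impI, elim conjE)
    fix M :: "nat \<Rightarrow> complex^'n^'n" and L
    assume "\<forall>k. M k \<in> {M. \<exists>v\<in>sphere 0 1. M *v v = v}" and lim: "M \<longlonglongrightarrow> L"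
    then have "\<forall>k. \<exists>v\<in>sphere 0 1. M k *v v = v"
      by simp
    then have "\<exists>v. \<forall>k. v k \<in> sphere 0 1 \<and> M k *v v k = v k"
      by (intro choice) blast
    then obtain v where v: "\<And>k. v k \<in> sphere 0 1" "\<And>k. M k *v v k = v k"
      by blast
    obtain x f where x: "x \<in> sphere 0 1" and f: "strict_mono f" "(v \<circ> f) \<longlonglongrightarrow> x"
      using compact_sphere[of "0 :: complex^'n" 1, unfolded compact_def, THEN spec[of _ v]] v(1) by blast
    have "(\<lambda>k. M (f k) *v v (f k)) \<longlonglongrightarrow> L *v x"
      using f LIMSEQ_subseq_LIMSEQ[OF lim f(1)] by (intro mv.tendsto) (simp_all add: o_def)
    then have "L *v x = x"
      using f(2) v(2) by (simp add: o_def LIMSEQ_unique)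
    then show "L \<in> {M. \<exists>v\<in>sphere 0 1. M *v v = v}"
      using x by auto
  qed
  have le: "closed {M :: complex^'n^'n. \<forall>v. qform M v \<le> v \<bullet> v}"
    unfolding qform_def
    by (intro closed_Collect_all closed_Collect_le continuous_intros mv.continuous_on)
  have eq: "(unit_effects :: (complex^'n^'n) set) = {M :: complex^'n^'n. pos_semidef M} \<inter> {M. \<forall>v. qform M v \<le> v \<bullet> v}
      \<inter> {M. \<exists>v\<in>sphere 0 1. M *v v = v}"
    by (auto simp: unit_effects_def)
  show ?thesis
    unfolding eq by (intro closed_Int closed_pos_semidef eig le)
qed

lemma compact_unit_effects: "compact unit_effects"
  by (simp add: compact_eq_bounded_closed bounded_unit_effects closed_unit_effects)

section \<open>Suprema of directed sets\<close>

lemma upwards_directed_finite_bound: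
  assumes "upwards_directed le S" "transp_on S le" "finite F" "F \<subseteq> S"
  obtains z where "z \<in> S" "\<And>x. x \<in> F \<Longrightarrow> le x z"
proof -
  have "\<exists>z\<in>S. \<forall>x\<in>F. le x z"
    using assms(3,4)
  proof induction
    case empty
    then show ?case
      using assms(1) by (auto simp: upwards_directed_def)
  next
    case (insert a F)
    then obtain y where y: "y \<in> S" "\<forall>x\<in>F. le x y"
      by auto
    obtain z where "z \<in> S" "le a z" "le y z"
      using assms(1) insert.prems y(1) unfolding upwards_directed_def by blast
    then show ?case
      using y insert.prems transp_onD[OF assms(2)] by blast
  qed
  then show thesis
    using that by blast
qed

text \<open>By compactness the closed tails of the family of normal forms have a common point
  \<open>L\<close>. It lies below each member, and any common lower bound of the members stays below
  \<open>L\<close> because \<open>L\<close> is in their closure. As normalization reverses the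
  order, the state of \<open>L\<close> is the supremum.\<close>

lemma directed_supremum_in_closure:
  fixes S :: "(complex^'n^'n) set"
  assumes S: "S \<subseteq> states" and dir: "upwards_directed qpe_le S"
  obtains s where "is_supremum states qpe_le S s" "normalized s \<in> closure (normalized ` S)"
proof -
  \<comment> \<open>The closed tail above \<open>r\<close>. An upper bound in \<open>S\<close> of
    finitely many elements lies in all their tails, which gives the finite intersection
    property.\<close>
  define C where "C r = closure (normalized ` {x \<in> S. qpe_le r x})" for r
  have trans: "transp_on S qpe_le"
    by (rule transp_on_qpe_le)
  have "unit_effects \<inter> \<Inter>(C ` S) \<noteq> {}"
  proof (rule compact_imp_fip_image)
    show "compact (unit_effects :: (complex^'n^'n) set)"
      by (rule compact_unit_effects)
    show "closed (C r)" for r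
      by (simp add: C_def)
    fix F assume F: "finite F" "F \<subseteq> S"
    then obtain z where z: "z \<in> S" "\<And>x. x \<in> F \<Longrightarrow> qpe_le x z"
      using upwards_directed_finite_bound[OF dir trans] by metis
    then have "normalized z \<in> C x" if "x \<in> F" for x
      using that unfolding C_def by (intro closure_subset[THEN subsetD] imageI) simp
    moreover have "normalized z \<in> unit_effects"
      using z(1) S by (intro normalized_in_unit_effects) auto
    ultimately show "unit_effects \<inter> \<Inter>(C ` F) \<noteq> {}"
      by blast
  qed
  then obtain L where L: "L \<in> unit_effects" "\<And>r. r \<in> S \<Longrightarrow> L \<in> C r"
    by blast
  obtain s where s: "s \<in> states" "normalized s = L"
    using normalized_surj[OF L(1)] .
  have le: "loewner_le L (normalized r)" if "r \<in> S" for r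
  proof -
    have "C r \<subseteq> {A. loewner_le A (normalized r)}"
      unfolding C_def by (rule closure_minimal[OF _ closed_loewner_atMost]) (auto simp: qpe_le_iff)
    then show ?thesis
      using L(2)[OF that] by blast
  qed
  have "S \<noteq> {}"
    using dir by (simp add: upwards_directed_def)
  then obtain r where "r \<in> S"
    by blast
  moreover have "C r \<subseteq> closure (normalized ` S)"
    unfolding C_def by (intro closure_mono image_mono) auto
  ultimately have cl: "L \<in> closure (normalized ` S)"
    using L(2) by blast
  have "loewner_le (normalized u) L" if "\<And>r. r \<in> S \<Longrightarrow> qpe_le r u" for u
  proof -
    have "closure (normalized ` S) \<subseteq> {A. loewner_le (normalized u) A}"
      using that by (intro closure_minimal[OF _ closed_loewner_atLeast]) (auto simp: qpe_le_iff)
    then show ?thesis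
      using cl by blast
  qed
  then have "is_supremum states qpe_le S s"
    using s le by (auto simp: is_supremum_def qpe_le_iff)
  then show thesis
    using that s(2) cl by simp
qed

lemma is_supremum_unique:
  assumes "is_supremum X le S s" "is_supremum X le S t" "antisymp_on X le"
  shows "s = t"
  using assms by (auto simp: is_supremum_def dest: antisymp_onD)


text \<open>The way-below relation speaks of arbitrary suprema; uniqueness transfers the closure
  property to them from the constructed one.\<close>

lemma supremum_in_closure:
  assumes "S \<subseteq> states" "upwards_directed qpe_le S" "is_supremum states qpe_le S s"
  shows "normalized s \<in> closure (normalized ` S)"
proof -
  obtain s' where "is_supremum states qpe_le S s'" "normalized s' \<in> closure (normalized ` S)"
    by (rule directed_supremum_in_closure[OF assms(1,2)])
  moreover from this(1) have "s = s'"
    by (rule is_supremum_unique[OF assms(3) _ antisymp_on_qpe_le])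
  ultimately show ?thesis
    by simp
qed

section \<open>The way-below relation\<close>

text \<open>The segment from \<open>M\<close> at \<open>s = 0\<close> to the identity, the normal
  form of \<open>bot_state\<close>, at \<open>s = 1\<close>.\<close>

definition depolarize :: "real \<Rightarrow> complex^'n^'n \<Rightarrow> complex^'n^'n" where
  "depolarize s M = (1 - s) *\<^sub>R M + s *\<^sub>R mat 1"

lemma qform_depolarize: "qform (depolarize s M) v = (1 - s) * qform M v + s * (v \<bullet> v)"
  by (simp add: depolarize_def qform_simps)

lemma hermitian_depolarize: "hermitian M \<Longrightarrow> hermitian (depolarize s M)"
  by (simp add: depolarize_def hermitian_add hermitian_scaleR hermitian_mat_1)

text \<open>A unit vector fixed by \<open>M\<close> is also fixed by the identity, hence by the
  mixture, so the eigenvalue 1 survives.\<close>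

lemma depolarize_in_unit_effects:
  assumes "M \<in> unit_effects" "0 \<le> s" "s \<le> 1"
  shows "depolarize s M \<in> unit_effects"
proof -
  obtain v where v: "norm v = 1" "M *v v = v"
    using assms(1) by (auto simp: unit_effects_def)
  then have "depolarize s M *v v = v"
    by (simp add: depolarize_def mv.add_left mv.scaleR_left flip: scaleR_add_left)
  moreover have "qform (depolarize s M) w \<le> w \<bullet> w" for w
  proof -
    have "(1 - s) * qform M w \<le> (1 - s) * (w \<bullet> w)"
      using assms by (intro mult_left_mono unit_effectsD) auto
    then show ?thesis
      by (simp add: qform_depolarize algebra_simps)
  qed
  moreover have "0 \<le> qform (depolarize s M) w" for w
    using assms by (simp add: qform_depolarize unit_effectsD)
  ultimately show ?thesis
    using v(1) assms(1) by (auto simp: unit_effects_def pos_semidef_iff hermitian_depolarize)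
qed

text \<open>The difference is \<open>(t - s) (I - M)\<close>. In the QPE order, moving towards the
  identity means going down.\<close>

lemma depolarize_mono:
  assumes "M \<in> unit_effects" "s \<le> t"
  shows "loewner_le (depolarize s M) (depolarize t M)"
proof -
  have "(t - s) * qform M v \<le> (t - s) * (v \<bullet> v)" for v
    using assms by (intro mult_left_mono unit_effectsD) auto
  then show ?thesis
    using assms(1) by (simp add: loewner_le_iff hermitian_depolarize unit_effectsD qform_depolarize algebra_simps)
qed

lemma depolarize_0 [simp]: "depolarize 0 M = M"
  by (simp add: depolarize_def)

text \<open>Let \<open>s\<close> tend to 0 from the right in the form at each fixed vector.\<close>

lemma loewner_le_depolarizeD:
  assumes "hermitian A" "M \<in> unit_effects" "\<And>s. 0 < s \<Longrightarrow> s \<le> 1 \<Longrightarrow> loewner_le A (depolarize s M)"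
  shows "loewner_le A M"
proof -
  have "qform A v \<le> qform M v" for v
  proof (rule tendsto_lowerbound)
    have "((\<lambda>s. (1 - s) * qform M v + s * (v \<bullet> v)) \<longlongrightarrow> (1 - 0) * qform M v + 0 * (v \<bullet> v)) (at_right 0)"
      by (intro tendsto_intros)
    then show "((\<lambda>s. qform (depolarize s M) v) \<longlongrightarrow> qform M v) (at_right 0)"
      by (simp add: qform_depolarize)
    have "\<forall>\<^sub>F s in at_right 0. s \<in> {0<..<1::real}"
      by (intro eventually_at_right_real) simp
    then show "\<forall>\<^sub>F s in at_right 0. qform A v \<le> qform (depolarize s M) v"
      by eventually_elim
        (use assms in \<open>simp add: loewner_le_iff hermitian_depolarize unit_effectsD\<close>)
  qed simp
  then show ?thesis
    using assms by (simp add: loewner_le_iff unit_effectsD)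
qed

section \<open>A chain of approximants and the characterization of way-below\<close>

text \<open>The value \<open>s = 0\<close>, which would give \<open>\<rho>\<close> itself, is
  excluded so that all members are way below \<open>\<rho>\<close>.\<close>

definition approximants :: "complex^'n^'n \<Rightarrow> (complex^'n^'n) set" where
  "approximants \<rho> = {\<tau> \<in> states. \<exists>s. 0 < s \<and> s \<le> 1 \<and> normalized \<tau> = depolarize s (normalized \<rho>)}"

lemma approximants_ex:
  assumes "\<rho> \<in> states" "0 < s" "s \<le> 1"
  obtains \<tau> where "\<tau> \<in> approximants \<rho>" "normalized \<tau> = depolarize s (normalized \<rho>)"
proof -
  have "depolarize s (normalized \<rho>) \<in> unit_effects"
    using assms by (simp add: depolarize_in_unit_effects normalized_in_unit_effects)
  then obtain \<tau> where "\<tau> \<in> states" "normalized \<tau> = depolarize s (normalized \<rho>)"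
    by (rule normalized_surj)
  then show thesis
    using assms that unfolding approximants_def by blast
qed

lemma directed_approximants:
  assumes "\<rho> \<in> states"
  shows "upwards_directed qpe_le (approximants \<rho>)"
proof -
  have M: "normalized \<rho> \<in> unit_effects"
    using assms by (rule normalized_in_unit_effects)
  have "\<exists>z\<in>approximants \<rho>. qpe_le x z \<and> qpe_le y z" if xy: "x \<in> approximants \<rho>" "y \<in> approximants \<rho>" for x y
  proof -
    obtain s t where st: "normalized x = depolarize s (normalized \<rho>)" "normalized y = depolarize t (normalized \<rho>)"
      using xy unfolding approximants_def by blast
    show ?thesis
    proof (cases "s \<le> t")
      case True
      then have "qpe_le y x"
        using st depolarize_mono[OF M] by (simp add: qpe_le_iff)
      then show ?thesis
        using xy(1) loewner_le_refl qpe_le_iff by blast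
    next
      case False
      then have "qpe_le x y"
        using st depolarize_mono[OF M] by (simp add: qpe_le_iff)
      then show ?thesis
        using xy(2) loewner_le_refl qpe_le_iff by blast
    qed
  qed
  moreover have "approximants \<rho> \<noteq> {}"
    using approximants_ex[OF assms, of 1] by auto
  ultimately show ?thesis
    by (auto simp: upwards_directed_def)
qed

lemma is_supremum_approximants:
  assumes "\<rho> \<in> states"
  shows "is_supremum states qpe_le (approximants \<rho>) \<rho>"
proof -
  have M: "normalized \<rho> \<in> unit_effects"
    using assms by (rule normalized_in_unit_effects)
  have "qpe_le \<tau> \<rho>" if "\<tau> \<in> approximants \<rho>" for \<tau>
    using that depolarize_mono[OF M, of 0] by (auto simp: approximants_def qpe_le_iff)
  moreover have "qpe_le \<rho> u" if u: "u \<in> states" "\<And>\<tau>. \<tau> \<in> approximants \<rho> \<Longrightarrow> qpe_le \<tau> u" for u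
    unfolding qpe_le_iff
  proof (rule loewner_le_depolarizeD[OF _ M])
    show "hermitian (normalized u)"
      using u(1) by (intro unit_effectsD normalized_in_unit_effects)
    fix s :: real assume "0 < s" "s \<le> 1"
    then obtain \<tau> where "\<tau> \<in> approximants \<rho>" "normalized \<tau> = depolarize s (normalized \<rho>)"
      by (rule approximants_ex[OF assms])
    then show "loewner_le (normalized u) (depolarize s (normalized \<rho>))"
      using u(2) qpe_le_iff by metis
  qed
  ultimately show ?thesis
    using assms by (auto simp: is_supremum_def)
qed

lemma qpe_way_below_iff:
  assumes \<tau>: "\<tau> \<in> states" and \<rho>: "\<rho> \<in> states"
  shows "qpe_way_below \<tau> \<rho> \<longleftrightarrow>
    (\<exists>s. 0 < s \<and> s \<le> 1 \<and> loewner_le (depolarize s (normalized \<rho>)) (normalized \<tau>))"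
proof
  assume "qpe_way_below \<tau> \<rho>"
  moreover have "approximants \<rho> \<subseteq> states"
    by (auto simp: approximants_def)
  moreover have "qpe_le \<rho> \<rho>"
    by (simp add: qpe_le_iff loewner_le_refl)
  \<comment> \<open>The way-below condition is tested on the chain of approximants, whose supremum
    is \<open>\<rho>\<close>.\<close>
  ultimately obtain z where "z \<in> approximants \<rho>" "qpe_le \<tau> z"
    using directed_approximants[OF \<rho>] is_supremum_approximants[OF \<rho>]
    unfolding way_below_def by blast
  then show "\<exists>s. 0 < s \<and> s \<le> 1 \<and> loewner_le (depolarize s (normalized \<rho>)) (normalized \<tau>)"
    by (auto simp: approximants_def qpe_le_iff)
next
  assume "\<exists>s. 0 < s \<and> s \<le> 1 \<and> loewner_le (depolarize s (normalized \<rho>)) (normalized \<tau>)"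
  then obtain s where s: "0 < s" "s \<le> 1" "loewner_le (depolarize s (normalized \<rho>)) (normalized \<tau>)"
    by blast
  show "qpe_way_below \<tau> \<rho>"
    unfolding way_below_def
  proof (intro conjI allI impI)
    fix S x assume S: "S \<subseteq> states" "upwards_directed qpe_le S"
      and sup: "is_supremum states qpe_le S x" and le: "qpe_le \<rho> x"
    define L where "L = normalized x"
    have L: "L \<in> unit_effects"
      using sup unfolding L_def is_supremum_def by (blast intro: normalized_in_unit_effects)
    have "pos_semidef (mat 1 - L)"
      using unit_effectsD[OF L] by (simp add: pos_semidef_iff hermitian_diff hermitian_mat_1 qform_simps)
    \<comment> \<open>Within this radius every \<open>B\<close> between 0 and \<open>I - L\<close>
      satisfies \<open>B \<le> s (I - L)\<close>; it is applied to
      \<open>B = normalized z - L\<close>.\<close>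
    then obtain e where e: "e > 0" "\<And>B v. pos_semidef B \<Longrightarrow> loewner_le B (mat 1 - L) \<Longrightarrow> norm B < e
        \<Longrightarrow> qform B v \<le> s * qform (mat 1 - L) v"
      using pos_semidef_small_le_scaleR s(1) by metis
    have "L \<in> closure (normalized ` S)"
      unfolding L_def using S sup by (rule supremum_in_closure)
    then obtain z where z: "z \<in> S" "norm (normalized z - L) < e"
      using e(1) by (auto simp: closure_approachable dist_norm)
    have M: "normalized z \<in> unit_effects" "normalized \<rho> \<in> unit_effects" "normalized \<tau> \<in> unit_effects"
      using z(1) S(1) \<rho> \<tau> by (auto intro: normalized_in_unit_effects)
    have "loewner_le L (normalized z)"
      using sup z(1) by (simp add: is_supremum_def qpe_le_iff L_def)
    moreover have "loewner_le (normalized z - L) (mat 1 - L)"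
      using unit_effectsD[OF M(1)] by (simp add: loewner_le_def pos_semidef_iff hermitian_diff
          hermitian_mat_1 qform_simps)
    ultimately have *: "qform (normalized z - L) v \<le> s * qform (mat 1 - L) v" for v
      using e(2) z(2) by (simp add: loewner_le_def)
    have "qform (normalized z) v \<le> qform (normalized \<tau>) v" for v
    proof -
      have "qform (normalized z) v \<le> (1 - s) * qform L v + s * (v \<bullet> v)"
        using *[of v] by (simp add: qform_simps algebra_simps)
      \<comment> \<open>Since \<open>\<rho>\<close> is below the supremum \<open>x\<close>, its
        normal form lies above \<open>L\<close>; \<open>s \<le> 1\<close> keeps the factor
        nonnegative.\<close>
      also have "\<dots> \<le> (1 - s) * qform (normalized \<rho>) v + s * (v \<bullet> v)"
        using le s(2) L M by (intro add_right_mono mult_left_mono)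
          (simp_all add: qpe_le_iff L_def loewner_le_iff unit_effectsD)
      also have "\<dots> \<le> qform (normalized \<tau>) v"
        using s(3) M by (simp add: loewner_le_iff hermitian_depolarize unit_effectsD qform_depolarize)
      finally show ?thesis .
    qed
    then have "qpe_le \<tau> z"
      using M by (simp add: qpe_le_iff loewner_le_iff unit_effectsD)
    then show "\<exists>z\<in>S. qpe_le \<tau> z"
      using z(1) by blast
  qed (use assms in auto)
qed

lemma approximants_way_below:
  assumes "\<rho> \<in> states" "\<tau> \<in> approximants \<rho>"
  shows "qpe_way_below \<tau> \<rho>"
proof -
  obtain s where "\<tau> \<in> states" "0 < s" "s \<le> 1" "normalized \<tau> = depolarize s (normalized \<rho>)"
    using assms(2) by (auto simp: approximants_def)
  moreover from this(4) have "loewner_le (depolarize s (normalized \<rho>)) (normalized \<tau>)"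
    by (simp add: loewner_le_refl)
  ultimately show ?thesis
    using assms(1) qpe_way_below_iff by blast
qed

section \<open>The domain property\<close>

lemma qpe_domain: "is_domain (states :: (complex^'n^'n) set) qpe_le"
  unfolding is_domain_def
proof (intro conjI ballI reflp_on_qpe_le transp_on_qpe_le antisymp_on_qpe_le)
  show "directed_complete (states :: (complex^'n^'n) set) qpe_le"
    unfolding directed_complete_def by (blast elim: directed_supremum_in_closure)
  fix \<rho> :: "complex^'n^'n" assume \<rho>: "\<rho> \<in> states"
  note M = normalized_in_unit_effects[OF \<rho>]
  let ?W = "{\<tau>. qpe_way_below \<tau> \<rho>}"
  have W: "\<tau> \<in> states" if "\<tau> \<in> ?W" for \<tau>
    using that by (simp add: way_below_def)
  have "approximants \<rho> \<subseteq> ?W"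
    using approximants_way_below[OF \<rho>] by blast
  show "upwards_directed qpe_le ?W"
    unfolding upwards_directed_def
  proof (intro conjI ballI)
    show "?W \<noteq> {}"
      using \<open>approximants \<rho> \<subseteq> ?W\<close> directed_approximants[OF \<rho>] by (auto simp: upwards_directed_def)
    fix x y assume xy: "x \<in> ?W" "y \<in> ?W"
    then obtain s t where st: "0 < s" "s \<le> 1" "loewner_le (depolarize s (normalized \<rho>)) (normalized x)"
      "0 < t" "t \<le> 1" "loewner_le (depolarize t (normalized \<rho>)) (normalized y)"
      using qpe_way_below_iff[OF W[OF xy(1)] \<rho>] qpe_way_below_iff[OF W[OF xy(2)] \<rho>] by auto
    \<comment> \<open>The smaller parameter gives the higher approximant, which therefore dominates
      both \<open>x\<close> and \<open>y\<close>.\<close>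
    obtain z where z: "z \<in> approximants \<rho>" "normalized z = depolarize (min s t) (normalized \<rho>)"
    proof (rule approximants_ex[OF \<rho>, of "min s t"])
      show "0 < min s t" "min s t \<le> 1"
        using st by auto
    qed
    have "qpe_le x z" "qpe_le y z"
      unfolding qpe_le_iff z(2)
      by (auto intro!: loewner_le_trans[OF depolarize_mono[OF M] st(3)]
          loewner_le_trans[OF depolarize_mono[OF M] st(6)])
    then show "\<exists>z\<in>?W. qpe_le x z \<and> qpe_le y z"
      using z(1) \<open>approximants \<rho> \<subseteq> ?W\<close> by blast
  qed
  have "qpe_le \<tau> \<rho>" if \<tau>: "\<tau> \<in> ?W" for \<tau>
  proof -
    obtain s where "0 < s" "loewner_le (depolarize s (normalized \<rho>)) (normalized \<tau>)"
      using \<tau> qpe_way_below_iff[OF W[OF \<tau>] \<rho>] by auto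
    then show ?thesis
      using depolarize_mono[OF M, of 0 s] loewner_le_trans unfolding qpe_le_iff by fastforce
  qed
  \<comment> \<open>An upper bound of \<open>?W\<close> also bounds the approximants, whose least
    upper bound is \<open>\<rho>\<close>.\<close>
  then show "is_supremum states qpe_le ?W \<rho>"
    using is_supremum_approximants[OF \<rho>] \<open>approximants \<rho> \<subseteq> ?W\<close>
    unfolding is_supremum_def by (meson subsetD)
qed

section \<open>Mixtures, the bottom state and kernels\<close>

lemma states_convex:
  assumes "\<rho> \<in> states" "\<sigma> \<in> states" "0 \<le> t" "t \<le> 1"
  shows "(1 - t) *\<^sub>R \<rho> + t *\<^sub>R \<sigma> \<in> states"
  using assms
  by (simp add: states_def pos_semidef_iff hermitian_add hermitian_scaleR qform_simps trace_add trace_scaleR)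

lemma bot_state_in_states: "bot_state \<in> states"
  by (simp add: states_def bot_state_def pos_semidef_iff hermitian_scaleR hermitian_mat_1 qform_simps
      trace_scaleR trace_I)

lemma mat_1_in_unit_effects: "mat 1 \<in> unit_effects"
  by (auto simp: unit_effects_def pos_semidef_iff hermitian_mat_1 qform_mat_1 intro!: exI[of _ "axis _ 1"])

lemma normalized_bot_state: "normalized bot_state = mat 1"
  unfolding bot_state_def
  by (rule normalized_scaleR_unit_effect[OF mat_1_in_unit_effects]) simp

lemma normalized_mult: "\<rho> \<in> states \<Longrightarrow> max_eigenvalue \<rho> *\<^sub>R normalized \<rho> = \<rho>"
  using max_eigenvalue_state[of \<rho>] by (simp add: normalized_def)

text \<open>If \<open>\<rho> \<sqsubseteq> \<sigma>\<close>, every top eigenvector of \<open>\<sigma>\<close> is one of \<open>\<rho>\<close>, so highest eigenvalues are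
  additive on mixtures.\<close>
lemma normalized_mixture:
  assumes \<rho>: "\<rho> \<in> states" and \<sigma>: "\<sigma> \<in> states" and le: "qpe_le \<rho> \<sigma>" and t: "0 < t" "t \<le> 1"
  obtains r where "0 < r" "r \<le> 1"
    "normalized ((1 - t) *\<^sub>R \<sigma> + t *\<^sub>R \<rho>) = (1 - r) *\<^sub>R normalized \<sigma> + r *\<^sub>R normalized \<rho>"
proof -
  note M = normalized_in_unit_effects[OF \<rho>] normalized_in_unit_effects[OF \<sigma>]
  note pos = max_eigenvalue_state[OF \<rho>] max_eigenvalue_state[OF \<sigma>]
  \<comment> \<open>\<open>c\<close> turns out to be the highest eigenvalue of the mixture, and
    \<open>r\<close> is the share of it contributed by \<open>\<rho>\<close>.\<close>
  define c where "c = (1 - t) * max_eigenvalue \<sigma> + t * max_eigenvalue \<rho>"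
  define r where "r = t * max_eigenvalue \<rho> / c"
  have c: "c > 0"
    unfolding c_def using pos t by (intro add_nonneg_pos) auto
  have r: "0 < r" "r \<le> 1" "1 - r = (1 - t) * max_eigenvalue \<sigma> / c"
    using pos t c by (auto simp: r_def c_def field_simps)
  define E where "E = (1 - r) *\<^sub>R normalized \<sigma> + r *\<^sub>R normalized \<rho>"
  have qE: "qform E v = (1 - r) * qform (normalized \<sigma>) v + r * qform (normalized \<rho>) v" for v
    by (simp add: E_def qform_simps)
  have herm: "hermitian E"
    using M by (simp add: E_def hermitian_add hermitian_scaleR unit_effectsD)
  have upper: "qform E v \<le> v \<bullet> v" for v
    unfolding qE using M r by (intro convex_bound_le) (auto simp: unit_effectsD)
  obtain v where v: "norm v = 1" "normalized \<sigma> *v v = v"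
    using M(2) by (auto simp: unit_effects_def)
  \<comment> \<open>At the top eigenvector \<open>v\<close> of \<open>\<sigma>\<close> the left side
    is 1, while the right side is at most 1.\<close>
  have "qform (normalized \<sigma>) v \<le> qform (normalized \<rho>) v"
    using le M by (simp add: qpe_le_iff loewner_le_iff unit_effectsD)
  then have "qform (mat 1 - normalized \<rho>) v = 0"
    using v unit_effectsD(4)[OF M(1), of v] by (simp add: qform_simps) (simp add: qform_def)
  moreover have "pos_semidef (mat 1 - normalized \<rho>)"
    using unit_effectsD[OF M(1)] by (simp add: pos_semidef_iff hermitian_diff hermitian_mat_1 qform_simps)
  ultimately have "normalized \<rho> *v v = v"
    using pos_semidef_kernel by (fastforce simp: mv.diff_left)
  then have "E *v v = v"
    using v by (simp add: E_def mv.add_left mv.scaleR_left flip: scaleR_add_left)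
  moreover have "0 \<le> qform E v" for v
    using M r(1,2) by (simp add: qE unit_effectsD)
  ultimately have "E \<in> unit_effects"
    using herm upper v(1) by (auto simp: unit_effects_def pos_semidef_iff)
  have "c *\<^sub>R E = ((1 - t) * max_eigenvalue \<sigma>) *\<^sub>R normalized \<sigma> + (t * max_eigenvalue \<rho>) *\<^sub>R normalized \<rho>"
    using c r(3) by (simp add: E_def scaleR_add_right) (simp add: r_def)
  also have "\<dots> = (1 - t) *\<^sub>R \<sigma> + t *\<^sub>R \<rho>"
    using normalized_mult[OF \<rho>] normalized_mult[OF \<sigma>] by (metis scaleR_scaleR)
  finally have "normalized ((1 - t) *\<^sub>R \<sigma> + t *\<^sub>R \<rho>) = E"
    using normalized_scaleR_unit_effect[OF \<open>E \<in> unit_effects\<close> c] by simp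
  then show thesis
    using that r E_def by simp
qed

text \<open>The mixture has normal form \<open>(1 - r) M + r N\<close>, where \<open>M\<close> and
  \<open>N\<close> belong to \<open>\<sigma>\<close> and \<open>\<rho>\<close>. From
  \<open>N \<ge> depolarize s M\<close> it follows that this is at least
  \<open>depolarize (r * s) M\<close>, and \<open>r * s\<close> is still positive.\<close>

lemma mixture_way_below:
  assumes \<rho>: "\<rho> \<in> states" and \<sigma>: "\<sigma> \<in> states" and wb: "qpe_way_below \<rho> \<sigma>" and t: "0 < t" "t \<le> 1"
  shows "qpe_way_below ((1 - t) *\<^sub>R \<sigma> + t *\<^sub>R \<rho>) \<sigma>"
proof -
  note M = normalized_in_unit_effects[OF \<rho>] normalized_in_unit_effects[OF \<sigma>]
  obtain s where s: "0 < s" "s \<le> 1" "loewner_le (depolarize s (normalized \<sigma>)) (normalized \<rho>)"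
    using wb qpe_way_below_iff[OF \<rho> \<sigma>] by blast
  have "qpe_le \<rho> \<sigma>"
    using depolarize_mono[OF M(2), of 0 s] s(1) loewner_le_trans[OF _ s(3)] by (simp add: qpe_le_iff)
  then obtain r where r: "0 < r" "r \<le> 1"
    "normalized ((1 - t) *\<^sub>R \<sigma> + t *\<^sub>R \<rho>) = (1 - r) *\<^sub>R normalized \<sigma> + r *\<^sub>R normalized \<rho>"
    by (rule normalized_mixture[OF \<rho> \<sigma> _ t])
  have "qform (depolarize (r * s) (normalized \<sigma>)) v
      \<le> (1 - r) * qform (normalized \<sigma>) v + r * qform (normalized \<rho>) v" for v
  proof -
    have "qform (depolarize (r * s) (normalized \<sigma>)) v
        = (1 - r) * qform (normalized \<sigma>) v + r * qform (depolarize s (normalized \<sigma>)) v"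
      by (simp add: qform_depolarize algebra_simps)
    also have "\<dots> \<le> (1 - r) * qform (normalized \<sigma>) v + r * qform (normalized \<rho>) v"
      using s(3) r(1) M
      by (simp add: loewner_le_iff hermitian_depolarize unit_effectsD)
    finally show ?thesis .
  qed
  then have "loewner_le (depolarize (r * s) (normalized \<sigma>)) (normalized ((1 - t) *\<^sub>R \<sigma> + t *\<^sub>R \<rho>))"
    unfolding r(3) using M
    by (simp add: loewner_le_iff hermitian_depolarize hermitian_add hermitian_scaleR unit_effectsD qform_simps)
  moreover have "0 < r * s" "r * s \<le> 1"
    using r s by (auto intro: mult_le_one)
  ultimately show ?thesis
    using states_convex[OF \<sigma> \<rho>] t \<sigma> by (subst qpe_way_below_iff) auto
qed

text \<open>For \<open>s = 1\<close> every normal form is depolarized to the identity, the normal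
  form of \<open>bot_state\<close>.\<close>

lemma bot_state_way_below:
  assumes "\<rho> \<in> states"
  shows "qpe_way_below bot_state \<rho>"
  using assms
  by (auto simp: qpe_way_below_iff bot_state_in_states normalized_bot_state depolarize_def
      intro!: exI[of _ 1] loewner_le_refl)

text \<open>The characterization makes the normal form of \<open>\<rho>\<close> at least
  \<open>s\<close> times the identity, so it cannot vanish on a nonzero vector.\<close>

lemma kernel_trivial_if_way_below:
  assumes \<rho>: "\<rho> \<in> states" and \<sigma>: "\<sigma> \<in> states" and wb: "qpe_way_below \<rho> \<sigma>" and v: "\<rho> *v v = 0"
  shows "v = 0"
proof -
  note M = normalized_in_unit_effects[OF \<rho>] normalized_in_unit_effects[OF \<sigma>]
  obtain s where s: "0 < s" "s \<le> 1" "loewner_le (depolarize s (normalized \<sigma>)) (normalized \<rho>)"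
    using wb qpe_way_below_iff[OF \<rho> \<sigma>] by blast
  have "s * (v \<bullet> v) \<le> (1 - s) * qform (normalized \<sigma>) v + s * (v \<bullet> v)"
    using s M by (simp add: unit_effectsD)
  also have "\<dots> \<le> qform (normalized \<rho>) v"
    using s(3) M by (simp add: loewner_le_iff hermitian_depolarize unit_effectsD qform_depolarize)
  also have "\<dots> = 0"
    using v by (simp add: normalized_def qform_scaleR) (simp add: qform_def)
  finally show ?thesis
    using s(1) by (simp add: mult_le_0_iff flip: power2_norm_eq_inner)
qed

text \<open>Solve \<open>depolarize s M = normalized \<rho>\<close> for \<open>M\<close>; for small \<open>s\<close> the solution is still positive semidefinite.\<close>
lemma way_below_if_kernel_trivial:
  fixes \<rho> :: "complex^'n^'n"
  assumes \<rho>: "\<rho> \<in> states" and ker: "\<And>v. \<rho> *v v = 0 \<Longrightarrow> v = 0"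
  obtains \<sigma> where "\<sigma> \<in> states" "qpe_way_below \<rho> \<sigma>"
proof -
  note M = normalized_in_unit_effects[OF \<rho>]
  have "normalized \<rho> *v v = 0 \<Longrightarrow> v = 0" for v
    using ker max_eigenvalue_state[OF \<rho>] by (simp add: normalized_def mv.scaleR_left)
  then obtain d where d: "d > 0" "\<And>v. d * (v \<bullet> v) \<le> qform (normalized \<rho>) v"
    using pos_semidef_lower_bound[OF unit_effectsD(2)[OF M], of UNIV] by auto
  \<comment> \<open>The bound \<open>d\<close> keeps \<open>M'\<close> positive semidefinite, and
    \<open>1/2\<close> keeps the divisor \<open>1 - s\<close> positive.\<close>
  define s where "s = min d (1/2)"
  have s: "0 < s" "s < 1" "s \<le> d"
    using d by (auto simp: s_def)
  define M' where "M' = (1 / (1 - s)) *\<^sub>R (normalized \<rho> - s *\<^sub>R mat 1)"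
  have rho_eq: "depolarize s M' = normalized \<rho>"
    using s by (simp add: depolarize_def M'_def)
  have q: "qform M' v = (qform (normalized \<rho>) v - s * (v \<bullet> v)) / (1 - s)" for v
    by (simp add: M'_def qform_simps)
  have "s * (v \<bullet> v) \<le> qform (normalized \<rho>) v" for v
    using d(2)[of v] s(3) by (meson inner_ge_zero mult_right_mono order_trans)
  then have "0 \<le> qform M' v" for v
    using s by (simp add: q)
  moreover have "qform M' v \<le> v \<bullet> v" for v
    using unit_effectsD(4)[OF M, of v] s by (simp add: q field_simps)
  moreover obtain v where v: "norm v = 1" "normalized \<rho> *v v = v"
    using M by (auto simp: unit_effects_def)
  moreover have "M' *v v = v"
  proof -
    have "M' *v v = (1 / (1 - s)) *\<^sub>R ((1 - s) *\<^sub>R v)"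
      using v by (simp add: M'_def mv.scaleR_left mv.diff_left scaleR_diff_left)
    then show ?thesis
      using s by simp
  qed
  moreover have "hermitian M'"
    using M by (simp add: M'_def hermitian_scaleR hermitian_diff hermitian_mat_1 unit_effectsD)
  ultimately have "M' \<in> unit_effects"
    by (auto simp: unit_effects_def pos_semidef_iff)
  then obtain \<sigma> where \<sigma>: "\<sigma> \<in> states" "normalized \<sigma> = M'"
    by (rule normalized_surj)
  have "qpe_way_below \<rho> \<sigma>"
    unfolding qpe_way_below_iff[OF \<rho> \<sigma>(1)] \<sigma>(2)
    using s rho_eq by (auto intro!: exI[of _ s] loewner_le_refl)
  then show thesis
    using that \<sigma>(1) by blast
qed

theorem theorem6:
  shows "is_domain (states :: (complex^'n^'n) set) qpe_le \<and>
    (\<forall>\<rho> \<in> (states :: (complex^'n^'n) set). \<forall>t::real. 0 < t \<and> t \<le> 1 \<longrightarrow>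
       qpe_way_below ((1 - t) *\<^sub>R \<rho> + t *\<^sub>R bot_state) \<rho>) \<and>
    (\<forall>\<rho> \<in> (states :: (complex^'n^'n) set). \<forall>\<sigma> \<in> states. qpe_way_below \<rho> \<sigma> \<longrightarrow>
       (\<forall>t::real. 0 < t \<and> t \<le> 1 \<longrightarrow>
          qpe_way_below ((1 - t) *\<^sub>R \<sigma> + t *\<^sub>R \<rho>) \<sigma>)) \<and>
    (\<forall>\<rho> \<in> (states :: (complex^'n^'n) set).
       (\<exists>\<sigma> \<in> states. qpe_way_below \<rho> \<sigma>) \<longleftrightarrow> {v. \<rho> *v v = 0} = {0})"
proof (intro conjI ballI allI impI)
  show "is_domain (states :: (complex^'n^'n) set) qpe_le"
    by (rule qpe_domain)
next
  fix \<rho> :: "complex^'n^'n" and t :: real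
  assume "\<rho> \<in> states" "0 < t \<and> t \<le> 1"
  \<comment> \<open>This is the general mixture statement applied to \<open>bot_state\<close>, which
    is way below every state.\<close>
  then show "qpe_way_below ((1 - t) *\<^sub>R \<rho> + t *\<^sub>R bot_state) \<rho>"
    by (intro mixture_way_below bot_state_in_states bot_state_way_below) auto
next
  fix \<rho> \<sigma> :: "complex^'n^'n" and t :: real
  assume "\<rho> \<in> states" "\<sigma> \<in> states" "qpe_way_below \<rho> \<sigma>" "0 < t \<and> t \<le> 1"
  then show "qpe_way_below ((1 - t) *\<^sub>R \<sigma> + t *\<^sub>R \<rho>) \<sigma>"
    by (intro mixture_way_below) auto
next
  fix \<rho> :: "complex^'n^'n" assume \<rho>: "\<rho> \<in> states"
  show "(\<exists>\<sigma> \<in> states. qpe_way_below \<rho> \<sigma>) \<longleftrightarrow> {v. \<rho> *v v = 0} = {0}"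
  proof
    assume "\<exists>\<sigma> \<in> states. qpe_way_below \<rho> \<sigma>"
    then show "{v. \<rho> *v v = 0} = {0}"
      using kernel_trivial_if_way_below[OF \<rho>] by auto
  next
    assume "{v. \<rho> *v v = 0} = {0}"
    then have ker: "v = 0" if "\<rho> *v v = 0" for v
      using that by blast
    obtain \<sigma> where "\<sigma> \<in> states" "qpe_way_below \<rho> \<sigma>"
      by (rule way_below_if_kernel_trivial[OF \<rho> ker])
    then show "\<exists>\<sigma> \<in> states. qpe_way_below \<rho> \<sigma>"
      by blast
  qed
qed

end
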